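(* Let $V$ be a finite set of Boolean variables, $\Phi$ a propositional formula over $V$, $\psi$ a specification, and $\gamma$ a generalizer. Let $\mathsf{Sol}$ denote the set of assignments output by an execution of $\mathrm{GCG}(\Phi,\psi,\gamma)$. (1) (Soundness) In every execution, every $\sigma\in\mathsf{Sol}$ satisfies $\sigma\models\Phi$ and $M_\sigma\models\psi$. (2) (Completeness) If $\gamma$ is proper, then for every terminated execution and every assignment $\sigma$ with $\sigma\models\Phi$ and $M_\sigma\models\psi$, we have $\sigma\in\mathsf{Sol}$.
   Context: Setting. Each assignment $\sigma:V\to\{0,1\}$ determines a model $M_\sigma$ (e.g. a labeled transition system), and $\psi$ is a specification with a satisfaction relation, written $M\models\psi$ / $M\not\models\psi$. For an assignment $\sigma$ and a formula $\varphi$ over $V$, $\sigma\models\varphi$ means $\sigma$ satisfies $\varphi$. An assignment $\sigma$ is also identified with the formula satisfied by $\sigma$ and by no other assignment, so $\neg\sigma$ is satisfied by all assignments except $\sigma$. A generalizer is a function $\gamma$ mapping assignments to propositional formulas over $V$. It is proper (with respect to the input formula $\Phi$ and $\psi$) if for every $\sigma$ with $\sigma\models\Phi$ and $M_\sigma\not\models\psi$: (i) $\sigma\models\gamma(\sigma)$; and (ii) for every $\rho$ with $\rho\models\Phi$ and $M_\rho\models\psi$, we have $\rho\not\models\gamma(\sigma)$. Algorithm $\mathrm{GCG}(\Phi,\psi,\gamma)$ (enumeration mode). Keep a current formula $\Phi_{cur}$, initialized to $\Phi$. While $\Phi_{cur}$ is satisfiable: - pick an arbitrary assignment $\sigma$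 with $\sigma\models\Phi_{cur}$ (a "candidate"); - if $M_\sigma\models\psi$, output $\sigma$ (a "solution") and set $\Phi_{cur}:=\Phi_{cur}\wedge\neg\sigma$; - otherwise set $\Phi_{cur}:=\Phi_{cur}\wedge\neg\gamma(\sigma)$. *)

theory Defs
  imports "HOL-Library.FuncSet" "HOL-Library.Extended_Nat"
begin

datatype (atoms: 'v) fm =
    Falsum
  | Verum
  | Atom 'v
  | Neg "'v fm"
  | Conj "'v fm" "'v fm"
  | Disj "'v fm" "'v fm"
  | Impl "'v fm" "'v fm"
  | Equiv "'v fm" "'v fm"

primrec sat :: "('v \<Rightarrow> bool) \<Rightarrow> 'v fm \<Rightarrow> bool" (infix "\<Turnstile>" 50) where
  "\<sigma> \<Turnstile> Falsum \<longleftrightarrow> False"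
| "\<sigma> \<Turnstile> Verum \<longleftrightarrow> True"
| "\<sigma> \<Turnstile> Atom x \<longleftrightarrow> \<sigma> x"
| "\<sigma> \<Turnstile> Neg \<phi> \<longleftrightarrow> \<not> \<sigma> \<Turnstile> \<phi>"
| "\<sigma> \<Turnstile> Conj \<phi> \<chi> \<longleftrightarrow> \<sigma> \<Turnstile> \<phi> \<and> \<sigma> \<Turnstile> \<chi>"
| "\<sigma> \<Turnstile> Disj \<phi> \<chi> \<longleftrightarrow> \<sigma> \<Turnstile> \<phi> \<or> \<sigma> \<Turnstile> \<chi>"
| "\<sigma> \<Turnstile> Impl \<phi> \<chi> \<longleftrightarrow> (\<sigma> \<Turnstile> \<phi> \<longrightarrow> \<sigma> \<Turnstile> \<chi>)"
| "\<sigma> \<Turnstile> Equiv \<phi> \<chi> \<longleftrightarrow> (\<sigma> \<Turnstile> \<phi> \<longleftrightarrow> \<sigma> \<Turnstile> \<chi>)"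

text \<open>Functions are taken extensional outside \<open>V\<close>, so that two assignments are equal
  as soon as they agree on \<open>V\<close>.\<close>

definition assignments :: "'v set \<Rightarrow> ('v \<Rightarrow> bool) set" where
  "assignments V = V \<rightarrow>\<^sub>E UNIV"

definition formula_over :: "'v set \<Rightarrow> 'v fm \<Rightarrow> bool" where
  "formula_over V \<phi> \<longleftrightarrow> atoms \<phi> \<subseteq> V"

definition satisfiable :: "'v set \<Rightarrow> 'v fm \<Rightarrow> bool" where
  "satisfiable V \<phi> \<longleftrightarrow> (\<exists>\<sigma>\<in>assignments V. \<sigma> \<Turnstile> \<phi>)"

text \<open>The formula identified with an assignment: the conjunction of the literals over \<open>V\<close>
  that are true under \<open>\<sigma>\<close>, in some fixed order. It is meaningful for finite \<open>V\<close>.\<close>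

definition assignment_fm :: "'v set \<Rightarrow> ('v \<Rightarrow> bool) \<Rightarrow> 'v fm" where
  "assignment_fm V \<sigma> =
     foldr (\<lambda>x. Conj (if \<sigma> x then Atom x else Neg (Atom x))) (SOME xs. set xs = V) Verum"

lemma sat_foldr_literals:
  "\<rho> \<Turnstile> foldr (\<lambda>x. Conj (if \<sigma> x then Atom x else Neg (Atom x))) xs Verum
     \<longleftrightarrow> (\<forall>x\<in>set xs. \<rho> x = \<sigma> x)"
  by (induction xs) auto

lemma atoms_foldr_literals:
  "atoms (foldr (\<lambda>x. Conj (if \<sigma> x then Atom x else Neg (Atom x))) xs Verum) = set xs"
  by (induction xs) auto

lemma sat_assignment_fm_iff:
  assumes "finite V" "\<sigma> \<in> assignments V" "\<rho> \<in> assignments V"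
  shows "\<rho> \<Turnstile> assignment_fm V \<sigma> \<longleftrightarrow> \<rho> = \<sigma>"
proof -
  have "set (SOME xs. set xs = V) = V"
    using finite_list[OF assms(1)] by (rule someI_ex)
  then have "\<rho> \<Turnstile> assignment_fm V \<sigma> \<longleftrightarrow> (\<forall>x\<in>V. \<rho> x = \<sigma> x)"
    by (simp add: assignment_fm_def sat_foldr_literals)
  also have "\<dots> \<longleftrightarrow> \<rho> = \<sigma>"
    using assms(2,3) unfolding assignments_def by (auto intro: PiE_ext)
  finally show ?thesis .
qed

lemma formula_over_assignment_fm:
  assumes "finite V"
  shows "formula_over V (assignment_fm V \<sigma>)"
proof -
  have "set (SOME xs. set xs = V) = V"
    using finite_list[OF assms] by (rule someI_ex)
  then show ?thesis
    by (simp add: formula_over_def assignment_fm_def atoms_foldr_literals)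
qed

definition generalizer :: "'v set \<Rightarrow> (('v \<Rightarrow> bool) \<Rightarrow> 'v fm) \<Rightarrow> bool" where
  "generalizer V \<gamma> \<longleftrightarrow> (\<forall>\<sigma>\<in>assignments V. formula_over V (\<gamma> \<sigma>))"

definition proper_generalizer ::
  "'v set \<Rightarrow> (('v \<Rightarrow> bool) \<Rightarrow> 'm) \<Rightarrow> ('m \<Rightarrow> 's \<Rightarrow> bool) \<Rightarrow> 'v fm \<Rightarrow> 's
     \<Rightarrow> (('v \<Rightarrow> bool) \<Rightarrow> 'v fm) \<Rightarrow> bool" where
  "proper_generalizer V M models \<Phi> \<psi> \<gamma> \<longleftrightarrow>
     (\<forall>\<sigma>\<in>assignments V. \<sigma> \<Turnstile> \<Phi> \<and> \<not> models (M \<sigma>) \<psi> \<longrightarrow>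
        \<sigma> \<Turnstile> \<gamma> \<sigma> \<and>
        (\<forall>\<rho>\<in>assignments V. \<rho> \<Turnstile> \<Phi> \<and> models (M \<rho>) \<psi> \<longrightarrow> \<not> \<rho> \<Turnstile> \<gamma> \<sigma>))"

text \<open>One loop iteration. A state consists of the current formula and the set of assignments
  output so far. The loop guard (satisfiability of the current formula) is implied by the
  existence of a candidate.\<close>

inductive gcg_step ::
  "'v set \<Rightarrow> (('v \<Rightarrow> bool) \<Rightarrow> 'm) \<Rightarrow> ('m \<Rightarrow> 's \<Rightarrow> bool) \<Rightarrow> 's \<Rightarrow> (('v \<Rightarrow> bool) \<Rightarrow> 'v fm)
     \<Rightarrow> 'v fm \<times> ('v \<Rightarrow> bool) set \<Rightarrow> 'v fm \<times> ('v \<Rightarrow> bool) set \<Rightarrow> bool"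
  for V M models \<psi> \<gamma> where
  solution:
    "\<sigma> \<in> assignments V \<Longrightarrow> \<sigma> \<Turnstile> \<Phi>cur \<Longrightarrow> models (M \<sigma>) \<psi> \<Longrightarrow>
     gcg_step V M models \<psi> \<gamma> (\<Phi>cur, Out) (Conj \<Phi>cur (Neg (assignment_fm V \<sigma>)), insert \<sigma> Out)"
| generalize:
    "\<sigma> \<in> assignments V \<Longrightarrow> \<sigma> \<Turnstile> \<Phi>cur \<Longrightarrow> \<not> models (M \<sigma>) \<psi> \<Longrightarrow>
     gcg_step V M models \<psi> \<gamma> (\<Phi>cur, Out) (Conj \<Phi>cur (Neg (\<gamma> \<sigma>)), Out)"

text \<open>An execution performs \<open>n\<close> loop iterations, where \<open>n = \<infinity>\<close> is allowed (without properness
  the loop need not terminate); \<open>s i\<close> is the state after \<open>i\<close> iterations, and the values \<open>s i\<close>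
  for \<open>i > n\<close> are irrelevant. A finite execution may be interrupted before the loop is left;
  termination is the separate condition below.\<close>

definition gcg_execution ::
  "'v set \<Rightarrow> (('v \<Rightarrow> bool) \<Rightarrow> 'm) \<Rightarrow> ('m \<Rightarrow> 's \<Rightarrow> bool) \<Rightarrow> 'v fm \<Rightarrow> 's
     \<Rightarrow> (('v \<Rightarrow> bool) \<Rightarrow> 'v fm) \<Rightarrow> (nat \<Rightarrow> 'v fm \<times> ('v \<Rightarrow> bool) set) \<Rightarrow> enat \<Rightarrow> bool" where
  "gcg_execution V M models \<Phi> \<psi> \<gamma> s n \<longleftrightarrow>
     s 0 = (\<Phi>, {}) \<and> (\<forall>i. enat i < n \<longrightarrow> gcg_step V M models \<psi> \<gamma> (s i) (s (Suc i)))"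

definition gcg_terminated ::
  "'v set \<Rightarrow> (nat \<Rightarrow> 'v fm \<times> ('v \<Rightarrow> bool) set) \<Rightarrow> enat \<Rightarrow> bool" where
  "gcg_terminated V s n \<longleftrightarrow> (\<exists>k. n = enat k \<and> \<not> satisfiable V (fst (s k)))"

definition gcg_Sol :: "(nat \<Rightarrow> 'v fm \<times> ('v \<Rightarrow> bool) set) \<Rightarrow> enat \<Rightarrow> ('v \<Rightarrow> bool) set" where
  "gcg_Sol s n = (\<Union>i\<in>{i. enat i \<le> n}. snd (s i))"

end

theory Submission
  imports Defs
begin

text \<open>Two loop invariants suffice: the current formula entails \<open>\<Phi>\<close> and all outputs are
  solutions; and, for proper \<open>\<gamma>\<close>, every solution that has not been output still satisfies the
  current formula. On termination nothing satisfies the current formula.\<close>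

text \<open>Both loop invariants are reduced to a check on single iterations. The bound
  \<open>enat i \<le> n\<close> stays in the induction, as states beyond \<open>n\<close> are
  unconstrained; \<open>n\<close> may be infinite, since every state is reached after finitely many
  iterations.\<close>

lemma gcg_execution_invariant:
  assumes "gcg_execution V M models \<Phi> \<psi> \<gamma> s n"
    and "P (\<Phi>, {})"
    and "\<And>S T. gcg_step V M models \<psi> \<gamma> S T \<Longrightarrow> P S \<Longrightarrow> P T"
    and "enat i \<le> n"
  shows "P (s i)"
  using assms(4)
proof (induction i)
  case 0
  then show ?case using assms(1,2) by (simp add: gcg_execution_def)
next
  case (Suc i)
  then have "enat i < n" by (simp add: Suc_ile_eq)
  then have "gcg_step V M models \<psi> \<gamma> (s i) (s (Suc i))" and "P (s i)"
    using Suc.IH assms(1) by (simp_all add: gcg_execution_def)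
  then show ?case by (rule assms(3))
qed

text \<open>A candidate is only known to satisfy the current formula, so the first conjunct is what
  makes the second inductive. It persists because an iteration only adds conjuncts.\<close>

lemma gcg_execution_sound:
  assumes "gcg_execution V M models \<Phi> \<psi> \<gamma> s n" and "enat i \<le> n"
  shows "(\<forall>\<sigma>. \<sigma> \<Turnstile> fst (s i) \<longrightarrow> \<sigma> \<Turnstile> \<Phi>) \<and>
         (\<forall>\<sigma>\<in>snd (s i). \<sigma> \<in> assignments V \<and> \<sigma> \<Turnstile> \<Phi> \<and> models (M \<sigma>) \<psi>)"
  by (rule gcg_execution_invariant[OF assms(1) _ _ assms(2)]) (auto elim!: gcg_step.cases)

lemma gcg_execution_complete:
  assumes "gcg_execution V M models \<Phi> \<psi> \<gamma> s n" and "enat i \<le> n"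
    and "finite V" and "proper_generalizer V M models \<Phi> \<psi> \<gamma>"
    and "\<sigma> \<in> assignments V" and "\<sigma> \<Turnstile> \<Phi>" and "models (M \<sigma>) \<psi>"
  shows "\<sigma> \<Turnstile> fst (s i) \<or> \<sigma> \<in> snd (s i)"
proof -
  \<comment> \<open>Properness speaks only of candidates that satisfy \<Phi>, hence the entailment
    of \<Phi> is carried along in the invariant.\<close>
  have "(\<forall>\<rho>. \<rho> \<Turnstile> fst (s i) \<longrightarrow> \<rho> \<Turnstile> \<Phi>) \<and> (\<sigma> \<Turnstile> fst (s i) \<or> \<sigma> \<in> snd (s i))"
  proof (rule gcg_execution_invariant[OF assms(1) _ _ assms(2)])
    fix S T
    assume "gcg_step V M models \<psi> \<gamma> S T"
      and "(\<forall>\<rho>. \<rho> \<Turnstile> fst S \<longrightarrow> \<rho> \<Turnstile> \<Phi>) \<and> (\<sigma> \<Turnstile> fst S \<or> \<sigma> \<in> snd S)"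
    then show "(\<forall>\<rho>. \<rho> \<Turnstile> fst T \<longrightarrow> \<rho> \<Turnstile> \<Phi>) \<and> (\<sigma> \<Turnstile> fst T \<or> \<sigma> \<in> snd T)"
      using assms(3-7)
      \<comment> \<open>Blocking an output assignment excludes no other assignment, so \<sigma> is
        lost only when it is itself output. Blocking a generalization keeps \<sigma> by the second
        clause of properness.\<close>
      by cases (auto simp: sat_assignment_fm_iff proper_generalizer_def)
  qed (simp add: assms(6))
  then show ?thesis ..
qed

theorem theorem1:
  fixes V :: "'v set"
    and M :: "('v \<Rightarrow> bool) \<Rightarrow> 'm"
    and models :: "'m \<Rightarrow> 's \<Rightarrow> bool"
    and \<Phi> :: "'v fm"
    and \<psi> :: 's
    and \<gamma> :: "('v \<Rightarrow> bool) \<Rightarrow> 'v fm"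
  assumes "finite V"
    and "formula_over V \<Phi>"
    and "generalizer V \<gamma>"
  shows "(\<forall>s n. gcg_execution V M models \<Phi> \<psi> \<gamma> s n \<longrightarrow>
            (\<forall>\<sigma>\<in>gcg_Sol s n. \<sigma> \<in> assignments V \<and> \<sigma> \<Turnstile> \<Phi> \<and> models (M \<sigma>) \<psi>)) \<and>
         (proper_generalizer V M models \<Phi> \<psi> \<gamma> \<longrightarrow>
           (\<forall>s n. gcg_execution V M models \<Phi> \<psi> \<gamma> s n \<and> gcg_terminated V s n \<longrightarrow>
              (\<forall>\<sigma>\<in>assignments V. \<sigma> \<Turnstile> \<Phi> \<and> models (M \<sigma>) \<psi> \<longrightarrow> \<sigma> \<in> gcg_Sol s n)))"
proof (intro conjI impI allI ballI; (elim conjE)?)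
  fix s n \<sigma>
  assume "gcg_execution V M models \<Phi> \<psi> \<gamma> s n" and "\<sigma> \<in> gcg_Sol s n"
  then have "\<sigma> \<in> assignments V \<and> \<sigma> \<Turnstile> \<Phi> \<and> models (M \<sigma>) \<psi>"
    by (auto simp: gcg_Sol_def dest: gcg_execution_sound)
  then show "\<sigma> \<in> assignments V" and "\<sigma> \<Turnstile> \<Phi>" and "models (M \<sigma>) \<psi>"
    by simp_all
next
  fix s n \<sigma>
  assume proper: "proper_generalizer V M models \<Phi> \<psi> \<gamma>"
    and exec: "gcg_execution V M models \<Phi> \<psi> \<gamma> s n" and "gcg_terminated V s n"
    and \<sigma>: "\<sigma> \<in> assignments V" "\<sigma> \<Turnstile> \<Phi>" "models (M \<sigma>) \<psi>"
  then obtain k where k: "n = enat k" "\<not> satisfiable V (fst (s k))"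
    by (auto simp: gcg_terminated_def)
  then have "\<sigma> \<in> snd (s k)"
    using gcg_execution_complete[OF exec _ \<open>finite V\<close> proper \<sigma>, of k] \<sigma>(1)
    by (auto simp: satisfiable_def)
  \<comment> \<open>The union in \<open>gcg_Sol\<close> includes the last index, here
    \<open>k\<close>.\<close>
  then show "\<sigma> \<in> gcg_Sol s n"
    using k(1) by (auto simp: gcg_Sol_def)
qed

end
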